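(* If $G$ is a connected graph of order $n$, then $$b(G)\leq \left\lceil\frac{-3+\sqrt{24n+33}}{4}\right\rceil,$$ where $b(G)$ denotes the burning number of $G$.
   Context: Burning process on a finite graph $G$: initially all vertices are unburned. In each round, every already burned vertex spreads fire to all of its neighbors, which become burned, and at the same time one chooses an unburned vertex (if any remains) and changes its status to burned; burned vertices remain burned. The burning number $b(G)$ is the minimum number of rounds needed to burn all vertices of $G$. The order of $G$ is its number of vertices. *)

theory Defs
  imports Complex_Main
begin

definition simple_graph :: "'a set \<Rightarrow> ('a \<Rightarrow> 'a \<Rightarrow> bool) \<Rightarrow> bool" where
  "simple_graph V E \<longleftrightarrow> finite V \<and> (\<forall>u v. E u v \<longrightarrow> u \<in> V \<and> v \<in> V)
     \<and> (\<forall>u v. E u v \<longrightarrow> E v u) \<and> (\<forall>v. \<not> E v v)"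

definition connected_graph :: "'a set \<Rightarrow> ('a \<Rightarrow> 'a \<Rightarrow> bool) \<Rightarrow> bool" where
  "connected_graph V E \<longleftrightarrow> V \<noteq> {} \<and> (\<forall>u\<in>V. \<forall>v\<in>V. E\<^sup>*\<^sup>* u v)"

definition burn_step :: "'a set \<Rightarrow> ('a \<Rightarrow> 'a \<Rightarrow> bool) \<Rightarrow> 'a set \<Rightarrow> 'a \<Rightarrow> 'a set" where
  "burn_step V E B x = B \<union> {v \<in> V. \<exists>u\<in>B. E u v} \<union> {x}"

definition burned :: "'a set \<Rightarrow> ('a \<Rightarrow> 'a \<Rightarrow> bool) \<Rightarrow> 'a list \<Rightarrow> 'a set" where
  "burned V E xs = foldl (burn_step V E) {} xs"

definition burns :: "'a set \<Rightarrow> ('a \<Rightarrow> 'a \<Rightarrow> bool) \<Rightarrow> 'a list \<Rightarrow> bool" where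
  "burns V E xs \<longleftrightarrow> (\<forall>i < length xs. xs ! i \<in> V - burned V E (take i xs))
     \<and> burned V E xs = V"

definition burning_number :: "'a set \<Rightarrow> ('a \<Rightarrow> 'a \<Rightarrow> bool) \<Rightarrow> nat" where
  "burning_number V E = (LEAST k. \<exists>xs. length xs = k \<and> burns V E xs)"

end

theory Submission
  imports Defs
begin

text \<open>
  Burning a graph in \<open>k\<close> rounds amounts to covering it by balls of radii \<open>0, \<dots>, k - 1\<close>. In a BFS tree,
  let \<open>v\<close> be a deepest vertex below which two branches contain vertices at distance more than \<open>2r\<close>.
  The two deepest branches \<open>C1\<close>, \<open>C2\<close> at \<open>v\<close> are each covered by a ball of radius \<open>r\<close>, and for some
  \<open>i\<close> their union has at least \<open>2r + 1 + i\<close> vertices and is covered by balls of radii \<open>r\<close> and \<open>i\<close>.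
  So one may either spend the radius \<open>r\<close> and delete \<open>r + 1 + i div 2\<close> vertices, or spend \<open>r\<close> and some
  \<open>a \<ge> i\<close> and delete \<open>2r + 1 + i\<close> vertices; the rest stays connected. Always taking the largest
  radius \<open>r\<close> and pairing it with the least available \<open>a \<ge> i\<close> covers about \<open>3k\<^sup>2/4\<close> vertices, which
  suffices except for \<open>k = 6\<close>; there it also pays to spend smaller radii first.
\<close>

subsection \<open>Balls and connected vertex sets\<close>

definition gball :: "('a \<Rightarrow> 'a \<Rightarrow> bool) \<Rightarrow> 'a \<Rightarrow> nat \<Rightarrow> 'a set" where
  "gball E c r = {v. \<exists>k\<le>r. (E ^^ k) c v}"

lemma gball_refl [simp]: "c \<in> gball E c r"
  unfolding gball_def by (auto intro: exI[of _ 0])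

lemma gball_mono: "r \<le> s \<Longrightarrow> gball E c r \<subseteq> gball E c s"
  unfolding gball_def by (auto intro: order_trans)

lemma gball_trans:
  assumes "v \<in> gball E c r" "w \<in> gball E v s" "r + s \<le> t"
  shows "w \<in> gball E c t"
proof -
  obtain k l where "k \<le> r" "(E ^^ k) c v" "l \<le> s" "(E ^^ l) v w"
    using assms unfolding gball_def by auto
  then have "(E ^^ (k + l)) c w" "k + l \<le> t"
    using assms(3) by (auto simp: relpowp_add)
  then show ?thesis unfolding gball_def by blast
qed

lemma relpowp_sym:
  assumes "symp E" shows "(E ^^ k) u v \<Longrightarrow> (E ^^ k) v u"
proof (induction k arbitrary: v)
  case (Suc k)
  then obtain y where "(E ^^ k) u y" "E y v" by auto
  then have "E v y" "(E ^^ k) y u" using Suc assms by (auto dest: sympD)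
  then show ?case by (rule relpowp_Suc_I2)
qed auto

lemma gball_sym: "symp E \<Longrightarrow> v \<in> gball E c r \<Longrightarrow> c \<in> gball E v r"
  unfolding gball_def using relpowp_sym by fastforce

definition conn :: "('a \<Rightarrow> 'a \<Rightarrow> bool) \<Rightarrow> 'a set \<Rightarrow> bool" where
  "conn E U \<longleftrightarrow> (\<forall>u\<in>U. \<forall>v\<in>U. (\<lambda>a b. E a b \<and> a \<in> U \<and> b \<in> U)\<^sup>*\<^sup>* u v)"

lemma finite_ex_greatest:
  fixes f :: "'a \<Rightarrow> nat"
  assumes "finite S" "S \<noteq> {}"
  obtains x where "x \<in> S" "\<And>y. y \<in> S \<Longrightarrow> f y \<le> f x"
proof -
  have "Max (f ` S) \<in> f ` S" using assms by simp
  then obtain x where "x \<in> S" "f x = Max (f ` S)" by auto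
  then show thesis using that[of x] assms by simp
qed

subsection \<open>Detaching branches of a rooted tree\<close>

locale rooted_tree =
  fixes E :: "'a \<Rightarrow> 'a \<Rightarrow> bool" and U :: "'a set" and \<rho> :: 'a
    and par :: "'a \<Rightarrow> 'a" and dep :: "'a \<Rightarrow> nat"
  assumes symE: "symp E"
    and finU: "finite U"
    and root_in: "\<rho> \<in> U"
    and dep_root: "dep \<rho> = 0"
    and par_root: "par \<rho> = \<rho>"
    and par_in: "u \<in> U \<Longrightarrow> par u \<in> U"
    and par_edge: "u \<in> U \<Longrightarrow> u \<noteq> \<rho> \<Longrightarrow> E (par u) u"
    and dep_par: "u \<in> U \<Longrightarrow> u \<noteq> \<rho> \<Longrightarrow> dep u = Suc (dep (par u))"
begin

definition sub :: "'a \<Rightarrow> 'a set" where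
  "sub v = {u \<in> U. dep v \<le> dep u \<and> (par ^^ (dep u - dep v)) u = v}"

lemma anc_in: "u \<in> U \<Longrightarrow> (par ^^ m) u \<in> U"
  by (induction m) (auto simp: par_in)

lemma dep_par_eq: "u \<in> U \<Longrightarrow> dep (par u) = dep u - 1"
  using dep_par[of u] par_root dep_root by (cases "u = \<rho>") auto

lemma dep_anc: "u \<in> U \<Longrightarrow> dep ((par ^^ m) u) = dep u - m"
  by (induction m) (auto simp: dep_par_eq anc_in)

lemma anc_anc: "(par ^^ k) ((par ^^ m) u) = (par ^^ (k + m)) u"
  by (simp add: funpow_add)

lemma sub_subset: "sub v \<subseteq> U"
  unfolding sub_def by auto

lemma finite_sub [simp]: "finite (sub v)"
  using finU sub_subset finite_subset by blast

lemma sub_self: "v \<in> U \<Longrightarrow> v \<in> sub v"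
  unfolding sub_def by auto

lemma sub_dep: "u \<in> sub v \<Longrightarrow> dep v \<le> dep u"
  unfolding sub_def by auto

lemma sub_anc: "u \<in> sub v \<Longrightarrow> (par ^^ (dep u - dep v)) u = v"
  unfolding sub_def by auto

lemma sub_in: "u \<in> sub v \<Longrightarrow> v \<in> U"
  using anc_in[of u "dep u - dep v"] unfolding sub_def by auto

lemma in_sub_anc: "u \<in> U \<Longrightarrow> m \<le> dep u \<Longrightarrow> u \<in> sub ((par ^^ m) u)"
  unfolding sub_def by (auto simp: dep_anc)

lemma sub_trans: "u \<in> sub v \<Longrightarrow> v \<in> sub a \<Longrightarrow> u \<in> sub a"
proof -
  assume a: "u \<in> sub v" "v \<in> sub a"
  then have "dep a \<le> dep v" "dep v \<le> dep u" by (auto dest: sub_dep)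
  then have "dep u - dep a = (dep v - dep a) + (dep u - dep v)" by simp
  then have "(par ^^ (dep u - dep a)) u = a"
    using anc_anc[of "dep v - dep a" "dep u - dep v" u] sub_anc[OF a(1)] sub_anc[OF a(2)] by simp
  then show ?thesis using a \<open>dep a \<le> dep v\<close> \<open>dep v \<le> dep u\<close>
    unfolding sub_def by auto
qed

lemma sub_linear: "u \<in> sub a \<Longrightarrow> u \<in> sub b \<Longrightarrow> dep a \<le> dep b \<Longrightarrow> b \<in> sub a"
proof -
  assume a: "u \<in> sub a" "u \<in> sub b" "dep a \<le> dep b"
  then have "dep b \<le> dep u" by (auto dest: sub_dep)
  then have "dep u - dep a = (dep b - dep a) + (dep u - dep b)" using a by simp
  then have "(par ^^ (dep b - dep a)) b = a"
    using anc_anc[of "dep b - dep a" "dep u - dep b" u] sub_anc[OF a(1)] sub_anc[OF a(2)] by simp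
  then show ?thesis using a(3) sub_in[OF a(2)] unfolding sub_def by auto
qed

lemma sub_same_dep: "u \<in> sub a \<Longrightarrow> u \<in> sub b \<Longrightarrow> dep a = dep b \<Longrightarrow> a = b"
  using sub_anc by metis

lemma par_sub: "u \<in> U \<Longrightarrow> par u \<in> sub v \<Longrightarrow> u \<in> sub v"
proof -
  assume a: "u \<in> U" "par u \<in> sub v"
  have "u \<in> sub (par u)"
  proof (cases "u = \<rho>")
    case True then show ?thesis using a par_root sub_self by auto
  next
    case False
    then show ?thesis using in_sub_anc[of u 1] dep_par[of u] a by simp
  qed
  then show ?thesis using a sub_trans by blast
qed

lemma root_sub: "u \<in> U \<Longrightarrow> u \<in> sub \<rho>"
proof -
  assume u: "u \<in> U"
  have "dep ((par ^^ dep u) u) = 0" using u by (simp add: dep_anc)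
  then have "(par ^^ dep u) u = \<rho>" using dep_par[of "(par ^^ dep u) u"] anc_in u by force
  then show ?thesis unfolding sub_def using u dep_root by auto
qed

lemma root_in_sub: "\<rho> \<in> sub v \<Longrightarrow> v = \<rho>"
  using root_sub[of v] sub_in[of \<rho> v] sub_dep[of \<rho> v] dep_root sub_self[of \<rho>] root_in
    sub_same_dep[of \<rho> v \<rho>] by simp

lemma par_gball: "u \<in> U \<Longrightarrow> par u \<in> gball E u 1"
proof (cases "u = \<rho>")
  case False
  assume "u \<in> U"
  then have "E u (par u)" using par_edge[of u] False symE by (auto dest: sympD)
  then show ?thesis unfolding gball_def by (auto intro!: exI[of _ 1])
qed (simp add: par_root)

lemma anc_gball: "u \<in> U \<Longrightarrow> (par ^^ m) u \<in> gball E u m"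
proof (induction m)
  case (Suc m)
  then show ?case
    using gball_trans[of "(par ^^ m) u" E u m "par ((par ^^ m) u)" 1 "Suc m"]
      par_gball[of "(par ^^ m) u"] anc_in[of u m] by simp
qed simp

lemma sub_gball:
  assumes "u \<in> sub a" "u' \<in> sub a" "dep u + dep u' \<le> 2 * dep a + t"
  shows "u' \<in> gball E u t"
proof (rule gball_trans)
  show "a \<in> gball E u (dep u - dep a)"
    using assms anc_gball[of u "dep u - dep a"] sub_anc[of u a] sub_subset by auto
  show "u' \<in> gball E a (dep u' - dep a)"
    using anc_gball[of u' "dep u' - dep a"] sub_anc[OF assms(2)] assms(2) sub_subset
      gball_sym[OF symE, of a u'] by auto
  show "dep u - dep a + (dep u' - dep a) \<le> t"
    using assms sub_dep[of u a] sub_dep[of u' a] by simp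
qed

lemma card_anc:
  assumes "u \<in> U" "m \<le> Suc (dep u)"
  shows "card ((\<lambda>l. (par ^^ l) u) ` {..<m}) = m"
proof -
  have "inj_on (\<lambda>l. (par ^^ l) u) {..<m}"
  proof (rule inj_onI)
    fix k l assume "k \<in> {..<m}" "l \<in> {..<m}" "(par ^^ k) u = (par ^^ l) u"
    then have "dep u - k = dep u - l" "k \<le> dep u" "l \<le> dep u"
      using dep_anc[OF assms(1), of k] dep_anc[OF assms(1), of l] assms by auto
    then show "k = l" by simp
  qed
  then show ?thesis by (simp add: card_image)
qed

lemma anc_subset_sub:
  assumes "u \<in> sub v" "m \<le> Suc (dep u - dep v)"
  shows "(\<lambda>l. (par ^^ l) u) ` {..<m} \<subseteq> sub v"
proof safe
  fix l assume "l < m"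
  moreover have "u \<in> U" using assms sub_subset by auto
  moreover have "l \<le> dep u" "dep v \<le> dep u - l" using \<open>l < m\<close> assms(2) sub_dep[OF assms(1)] by auto
  ultimately show "(par ^^ l) u \<in> sub v"
    using sub_linear[OF assms(1) in_sub_anc, of l] by (simp add: dep_anc)
qed

lemma conn_closed:
  assumes "S \<subseteq> U" "\<rho> \<in> S" "\<And>u. u \<in> S \<Longrightarrow> par u \<in> S"
  shows "conn E S"
proof -
  let ?R = "\<lambda>a b. E a b \<and> a \<in> S \<and> b \<in> S"
  have sym: "symp ?R" using symE by (auto simp: symp_def)
  have "?R\<^sup>*\<^sup>* \<rho> u" if "u \<in> S" for u
    using that
  proof (induction "dep u" arbitrary: u)
    case 0
    then have "u = \<rho>" using dep_par assms(1) by (metis nat.simps(3) subsetD)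
    then show ?case by simp
  next
    case (Suc n)
    then have "u \<noteq> \<rho>" "u \<in> U" using dep_root assms by auto
    then have "?R (par u) u" "?R\<^sup>*\<^sup>* \<rho> (par u)"
      using Suc dep_par[of u] assms(3) par_edge by auto
    from this(2,1) show ?case by (rule rtranclp.rtrancl_into_rtrancl)
  qed
  moreover from this have "?R\<^sup>*\<^sup>* u \<rho>" if "u \<in> S" for u
    using sympD[OF symp_rtranclp[OF sym]] that by blast
  ultimately show ?thesis unfolding conn_def by (blast intro: rtranclp_trans)
qed

lemma conn_remove_sub:
  assumes "y \<noteq> \<rho>" "y' \<noteq> \<rho>"
  shows "conn E (U - (sub y \<union> sub y'))"
proof (rule conn_closed)
  show "\<rho> \<in> U - (sub y \<union> sub y')" using assms root_in_sub root_in by blast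
  show "par u \<in> U - (sub y \<union> sub y')" if "u \<in> U - (sub y \<union> sub y')" for u
    using that par_sub par_in by blast
qed auto

text \<open>
  The last conjunct says that \<open>v\<close> is the lowest common ancestor of \<open>u\<close> and \<open>u'\<close>, so that the first
  bounds their distance in the tree.
\<close>

definition wide :: "nat \<Rightarrow> 'a \<Rightarrow> bool" where
  "wide r v \<longleftrightarrow> (\<exists>u\<in>sub v. \<exists>u'\<in>sub v. 2 * r + 1 + 2 * dep v \<le> dep u + dep u'
      \<and> (\<forall>y\<in>sub v - {v}. \<not> (u \<in> sub y \<and> u' \<in> sub y)))"

lemma sub_covered:
  assumes good: "\<And>a. a \<in> sub v \<Longrightarrow> \<not> wide r a"
    and w: "w \<in> sub v" "\<And>u. u \<in> sub v \<Longrightarrow> dep u \<le> dep w"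
  shows "sub v \<subseteq> gball E ((par ^^ min r (dep w - dep v)) w) r"
proof
  fix y assume y: "y \<in> sub v"
  define c where "c = (par ^^ min r (dep w - dep v)) w"
  have wU: "w \<in> U" using w(1) sub_subset by auto
  have dc: "dep c = dep w - min r (dep w - dep v)" unfolding c_def using wU by (simp add: dep_anc)
  have wc: "w \<in> sub c" unfolding c_def using wU by (intro in_sub_anc) auto
  have "y \<in> gball E c r"
  proof (cases "y \<in> sub c")
    case True
    moreover have "c \<in> sub c" using wc sub_in sub_self by blast
    ultimately show ?thesis
      using w(2)[OF y] dc by (intro sub_gball[of c c]) auto
  next
    case False
    have "c \<noteq> v" using False y by auto
    have rm: "r < dep w - dep v"
    proof (rule ccontr)
      assume "\<not> ?thesis"
      then have "c = v" unfolding c_def using sub_anc[OF w(1)] by simp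
      then show False using \<open>c \<noteq> v\<close> by simp
    qed
    define S where "S = {a \<in> sub v. w \<in> sub a \<and> y \<in> sub a}"
    have "v \<in> S" unfolding S_def using w(1) y sub_in sub_self by auto
    moreover have "finite S" unfolding S_def by simp
    ultimately obtain a where a: "a \<in> S" "\<And>b. b \<in> S \<Longrightarrow> dep b \<le> dep a"
      using finite_ex_greatest[of S dep] by blast
    have "\<not> (w \<in> sub b \<and> y \<in> sub b)" if "b \<in> sub a - {a}" for b
    proof
      assume b: "w \<in> sub b \<and> y \<in> sub b"
      then have "b \<in> S" using that a(1) sub_trans unfolding S_def by auto
      then have "dep b = dep a" using a(2) sub_dep that by (simp add: le_antisym)
      then show False using sub_same_dep[of w b a] b a(1) that unfolding S_def by auto
    qed
    moreover have "\<not> wide r a" using good a unfolding S_def by auto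
    ultimately have "dep w + dep y < 2 * r + 1 + 2 * dep a"
      using a(1) unfolding S_def wide_def by (auto simp: not_le)
    moreover have "dep a < dep c"
    proof (rule ccontr)
      assume "\<not> ?thesis"
      then have "a \<in> sub c" using sub_linear[OF wc, of a] a(1) unfolding S_def by auto
      then show False using False a(1) sub_trans unfolding S_def by blast
    qed
    moreover have "c \<in> sub a" using sub_linear[of w a c] a(1) wc \<open>dep a < dep c\<close> unfolding S_def by auto
    ultimately show ?thesis
      using rm dc a(1) unfolding S_def by (intro sub_gball[of c a]) auto
  qed
  then show "y \<in> gball E ((par ^^ min r (dep w - dep v)) w) r" unfolding c_def .
qed

lemma detach_branches:
  "(\<exists>c. U \<subseteq> gball E c r)
   \<or> (\<exists>c v R. v \<in> U \<and> v \<noteq> \<rho> \<and> v \<notin> R \<and> \<rho> \<notin> R \<and> R \<subseteq> U \<and> insert v R \<subseteq> gball E c r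
        \<and> conn E (U - R) \<and> conn E (U - insert v R) \<and> 2 * r \<le> card R)
   \<or> (\<exists>v c1 c2 z i C1 C2. v \<in> U \<and> C1 \<subseteq> U \<and> C2 \<subseteq> U \<and> C1 \<inter> C2 = {}
        \<and> v \<notin> C1 \<union> C2 \<and> \<rho> \<notin> C1 \<union> C2
        \<and> insert v C1 \<subseteq> gball E c1 r \<and> insert v C2 \<subseteq> gball E c2 r
        \<and> C1 \<union> C2 \<subseteq> gball E c1 r \<union> gball E z i
        \<and> conn E (U - C1) \<and> conn E (U - C2) \<and> conn E (U - (C1 \<union> C2))
        \<and> 2 * r + 1 + i \<le> card C1 + card C2)"
  (is "?P1 \<or> ?P2 \<or> ?P3")
proof (cases "\<exists>v\<in>U. wide r v")
  case False
  have Usub: "U \<subseteq> sub \<rho>" using root_sub by auto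
  obtain w where w: "w \<in> U" "\<And>u. u \<in> U \<Longrightarrow> dep u \<le> dep w"
    using finite_ex_greatest[OF finU, of dep] root_in by blast
  have "sub \<rho> \<subseteq> gball E ((par ^^ min r (dep w - dep \<rho>)) w) r"
  proof (rule sub_covered)
    show "\<not> wide r a" if "a \<in> sub \<rho>" for a using that False sub_subset by blast
    show "dep u \<le> dep w" if "u \<in> sub \<rho>" for u using that w(2) sub_subset by blast
  qed (rule root_sub[OF w(1)])
  then show ?thesis using Usub by blast
next
  case True
  then have ne: "{v \<in> U. wide r v} \<noteq> {}" by auto
  have "finite {v \<in> U. wide r v}" using finU by simp
  from finite_ex_greatest[OF this ne, of dep] obtain v where v: "v \<in> {v \<in> U. wide r v}"
    and vmax: "\<And>a. a \<in> {v \<in> U. wide r v} \<Longrightarrow> dep a \<le> dep v"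
    by blast
  have vU: "v \<in> U" using v by simp
  have good: "\<not> wide r a" if "dep v < dep a" "a \<in> U" for a
    using vmax[of a] that by auto
  obtain w where w: "w \<in> sub v" and wmax: "\<And>u. u \<in> sub v \<Longrightarrow> dep u \<le> dep w"
    using finite_ex_greatest[of "sub v" dep] sub_self[OF vU] by (metis empty_iff finite_sub)
  have wU: "w \<in> U" using w sub_subset by auto
  define \<alpha> where "\<alpha> = dep w - dep v"
  have dw: "dep w = dep v + \<alpha>" using sub_dep[OF w] unfolding \<alpha>_def by simp
  obtain u u' where u: "u \<in> sub v" "u' \<in> sub v" "2 * r + 1 + 2 * dep v \<le> dep u + dep u'"
    "\<And>y. y \<in> sub v - {v} \<Longrightarrow> \<not> (u \<in> sub y \<and> u' \<in> sub y)"
    using v unfolding wide_def by auto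
  have \<alpha>r: "r + 1 \<le> \<alpha>" using wmax[OF u(1)] wmax[OF u(2)] u(3) dw by linarith
  show ?thesis
  proof (cases "2 * r + 1 \<le> \<alpha>")
    case True
    define v' where "v' = (par ^^ (2 * r)) w"
    have dv': "dep v' = dep w - 2 * r" unfolding v'_def using wU by (simp add: dep_anc)
    have v'U: "v' \<in> U" unfolding v'_def using wU anc_in by simp
    have wv': "w \<in> sub v'" unfolding v'_def using wU True dw by (intro in_sub_anc) auto
    have "v' \<in> sub v" using sub_linear[OF w wv'] dv' dw True by simp
    then have sub': "sub v' \<subseteq> sub v" using sub_trans by blast
    have "dep v < dep v'" using dv' dw True by simp
    then have "v' \<noteq> \<rho>" using dep_root by auto
    have cov: "sub v' \<subseteq> gball E ((par ^^ min r (dep w - dep v')) w) r"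
    proof (rule sub_covered)
      show "\<not> wide r a" if "a \<in> sub v'" for a
        using that \<open>dep v < dep v'\<close> sub_dep[OF that] sub_subset good[of a] by auto
    qed (use wv' wmax sub' in auto)
    have "2 * r + 1 \<le> card (sub v')"
      using card_mono[OF finite_sub anc_subset_sub[OF wv', of "2 * r + 1"]]
        card_anc[OF wU, of "2 * r + 1"] dv' dw True by simp
    moreover have ins: "insert v' (sub v' - {v'}) = sub v'" using sub_self[OF v'U] by auto
    ultimately have "2 * r \<le> card (sub v' - {v'})" using sub_self[OF v'U] by simp
    moreover have "conn E (U - sub v')" using conn_remove_sub[of v' v'] \<open>v' \<noteq> \<rho>\<close> by simp
    moreover have "conn E (U - (sub v' - {v'}))"
    proof (rule conn_closed)
      show "\<rho> \<in> U - (sub v' - {v'})" using root_in root_in_sub by blast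
      show "par a \<in> U - (sub v' - {v'})" if a: "a \<in> U - (sub v' - {v'})" for a
      proof -
        have "par a \<notin> sub v' - {v'}"
        proof
          assume pa: "par a \<in> sub v' - {v'}"
          then have "a = v'" using par_sub[of a v'] a by auto
          then have "dep v' \<le> dep (par v')" using pa sub_dep by auto
          then show False using dep_par[OF v'U \<open>v' \<noteq> \<rho>\<close>] by simp
        qed
        then show ?thesis using a par_in by auto
      qed
    qed auto
    moreover have "\<rho> \<notin> sub v' - {v'}" using root_in_sub by blast
    moreover have "v' \<notin> sub v' - {v'}" "sub v' - {v'} \<subseteq> U" using sub_subset by auto
    ultimately have ?P2 using cov v'U \<open>v' \<noteq> \<rho>\<close>
      by - (rule exI[of _ "(par ^^ min r (dep w - dep v')) w"], rule exI[of _ v'],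
          rule exI[of _ "sub v' - {v'}"], simp only: ins, intro conjI, simp_all only: not_False_eq_True)
    then show ?thesis by blast
  next
    case False
    then have \<alpha>2: "\<alpha> \<le> 2 * r" by simp
    have child: "(par ^^ (dep a - dep v - 1)) a \<in> U \<and> dep ((par ^^ (dep a - dep v - 1)) a) = Suc (dep v)
        \<and> a \<in> sub ((par ^^ (dep a - dep v - 1)) a) \<and> (par ^^ (dep a - dep v - 1)) a \<in> sub v"
      if "a \<in> sub v" "a \<noteq> v" for a
    proof -
      have aU: "a \<in> U" using that sub_subset by auto
      have "dep a \<noteq> dep v" using that sub_same_dep[of a a v] sub_self[OF aU] by auto
      then have lt: "dep v < dep a" using sub_dep[OF that(1)] by simp
      have "a \<in> sub ((par ^^ (dep a - dep v - 1)) a)" using aU by (intro in_sub_anc) auto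
      moreover have d: "dep ((par ^^ (dep a - dep v - 1)) a) = Suc (dep v)" using dep_anc[OF aU] lt by simp
      ultimately show ?thesis using sub_linear[OF that(1), of "(par ^^ (dep a - dep v - 1)) a"] anc_in[OF aU]
        by auto
    qed
    define y1 where "y1 = (par ^^ (dep w - dep v - 1)) w"
    have "w \<noteq> v" using dw \<alpha>r by auto
    from child[OF w this] have y1: "y1 \<in> U" "dep y1 = Suc (dep v)" "w \<in> sub y1" "y1 \<in> sub v"
      unfolding y1_def by auto
    define Z where "Z = sub v - sub y1"
    have y1v: "y1 \<in> sub v - {v}" using y1 by auto
    have "\<exists>a\<in>Z. 2 * r + 1 + dep v \<le> dep a + \<alpha>"
    proof (cases "u \<in> sub y1")
      case True
      then have "u' \<in> Z" using u(2) u(4)[OF y1v] unfolding Z_def by auto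
      then show ?thesis using u(3) wmax[OF u(1)] dw by (intro bexI[of _ u']) auto
    next
      case False
      then have "u \<in> Z" using u(1) unfolding Z_def by auto
      then show ?thesis using u(3) wmax[OF u(2)] dw by (intro bexI[of _ u]) auto
    qed
    then obtain a where a: "a \<in> Z" "2 * r + 1 + dep v \<le> dep a + \<alpha>" by blast
    obtain x where x: "x \<in> Z" and xmax: "\<And>y. y \<in> Z \<Longrightarrow> dep y \<le> dep x"
      using finite_ex_greatest[of Z dep] a(1) unfolding Z_def by (metis empty_iff finite_Diff finite_sub)
    have xv: "x \<in> sub v" and xy1: "x \<notin> sub y1" using x unfolding Z_def by auto
    have xU: "x \<in> U" using xv sub_subset by auto
    define \<beta> where "\<beta> = dep x - dep v"
    have dx: "dep x = dep v + \<beta>" using sub_dep[OF xv] unfolding \<beta>_def by simp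
    have \<alpha>\<beta>: "2 * r + 1 \<le> \<alpha> + \<beta>" using a(2) xmax[OF a(1)] dx by simp
    have \<beta>\<alpha>: "\<beta> \<le> \<alpha>" using wmax[OF xv] dx dw by simp
    define y2 where "y2 = (par ^^ (dep x - dep v - 1)) x"
    have "x \<noteq> v" using dx \<alpha>\<beta> \<alpha>2 by auto
    from child[OF xv this] have y2: "y2 \<in> U" "dep y2 = Suc (dep v)" "x \<in> sub y2" "y2 \<in> sub v"
      unfolding y2_def by auto
    have "y1 \<noteq> y2" using y2(3) xy1 by auto
    have disj: "sub y1 \<inter> sub y2 = {}"
      using sub_same_dep[of _ y1 y2] y1(2) y2(2) \<open>y1 \<noteq> y2\<close> by auto
    have sub1: "sub y1 \<subseteq> sub v" and sub2: "sub y2 \<subseteq> sub v" using y1 y2 sub_trans by blast+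
    have sub2Z: "sub y2 \<subseteq> Z" using sub2 disj unfolding Z_def by auto
    have root12: "y1 \<noteq> \<rho>" "y2 \<noteq> \<rho>" using y1(2) y2(2) dep_root by auto
    define c1 where "c1 = (par ^^ r) w"
    have dc1: "dep c1 = dep v + (\<alpha> - r)" unfolding c1_def using wU dw \<alpha>r by (simp add: dep_anc)
    have wc1: "w \<in> sub c1" unfolding c1_def using wU dw \<alpha>r by (intro in_sub_anc) auto
    have c1v: "c1 \<in> sub v" using sub_linear[OF w wc1] dc1 by simp
    define c2 where "c2 = (par ^^ min r (dep x - dep y2)) x"
    have xc2: "x \<in> sub c2" unfolding c2_def using xU by (intro in_sub_anc) auto
    have dc2: "dep c2 = dep v + (\<beta> - min r (\<beta> - 1))"
      unfolding c2_def using xU dx y2(2) by (simp add: dep_anc)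
    have c2v: "c2 \<in> sub v" using sub_linear[OF xv xc2] dc2 by simp
    have cov1: "sub y1 \<subseteq> gball E c1 r"
    proof -
      have "sub y1 \<subseteq> gball E ((par ^^ min r (dep w - dep y1)) w) r"
      proof (rule sub_covered)
        show "\<not> wide r b" if "b \<in> sub y1" for b
          using that y1(2) sub_dep[OF that] sub_subset good[of b] by auto
      qed (use y1 sub1 wmax in auto)
      moreover have "min r (dep w - dep y1) = r" using dw y1(2) \<alpha>r by auto
      ultimately show ?thesis unfolding c1_def by simp
    qed
    have cov2: "sub y2 \<subseteq> gball E c2 r"
      unfolding c2_def
    proof (rule sub_covered)
      show "\<not> wide r b" if "b \<in> sub y2" for b
        using that y2(2) sub_dep[OF that] sub_subset good[of b] by auto
    qed (use y2 sub2Z xmax in auto)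
    have vv: "v \<in> sub v" using sub_self vU by simp
    have v1: "v \<in> gball E c1 r"
      using c1v vv dc1 \<alpha>2 by (intro sub_gball[of c1 v]) auto
    have v2: "v \<in> gball E c2 r"
      using c2v vv dc2 \<alpha>2 \<beta>\<alpha> \<alpha>r by (intro sub_gball[of c2 v]) auto
    \<comment> \<open>\<open>X\<close> is the part of the second branch out of reach of \<open>c1\<close>, and \<open>z\<close> its lowest common ancestor
      with \<open>x\<close>. Any \<open>y \<in> X\<close> not below the child of \<open>z\<close> towards \<open>x\<close> yields a second path in that branch.\<close>
    define X where "X = {y \<in> sub y2. dep v + 2 * r < dep y + \<alpha>}"
    have xX: "x \<in> X" unfolding X_def using y2(3) dx \<alpha>\<beta> by auto
    define i where "i = (LEAST m. X \<subseteq> sub ((par ^^ m) x))"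
    have ex: "X \<subseteq> sub ((par ^^ (\<beta> - 1)) x)" using y2_def dx unfolding X_def by auto
    have Xi: "X \<subseteq> sub ((par ^^ i) x)" unfolding i_def using ex by (rule LeastI)
    have i\<beta>: "i \<le> \<beta> - 1" unfolding i_def using ex by (rule Least_le)
    define z where "z = (par ^^ i) x"
    have dz: "dep z = dep x - i" unfolding z_def using xU by (simp add: dep_anc)
    have zz: "z \<in> sub z" unfolding z_def using xU anc_in sub_self by simp
    have Xz: "X \<subseteq> gball E z i"
    proof
      fix y assume y: "y \<in> X"
      then have "dep y \<le> dep x" using xmax sub2Z unfolding X_def by auto
      then show "y \<in> gball E z i"
        using y Xi zz dz unfolding z_def[symmetric] by (intro sub_gball[of z z]) auto
    qed
    have "\<exists>y\<in>X. \<forall>l<i. y \<notin> sub ((par ^^ l) x)"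
    proof (cases i)
      case 0
      then show ?thesis using xX by auto
    next
      case (Suc m)
      then have "m < (LEAST m. X \<subseteq> sub ((par ^^ m) x))" unfolding i_def by simp
      then have "\<not> X \<subseteq> sub ((par ^^ m) x)" by (rule not_less_Least)
      then obtain y where y: "y \<in> X" "y \<notin> sub ((par ^^ m) x)" by auto
      have "y \<notin> sub ((par ^^ l) x)" if "l < i" for l
      proof
        assume yl: "y \<in> sub ((par ^^ l) x)"
        have "l \<le> dep x" "m \<le> dep x" "dep x - m \<le> dep x - l" using that i\<beta> Suc dx by auto
        then have "(par ^^ l) x \<in> sub ((par ^^ m) x)"
          using sub_linear[OF in_sub_anc[OF xU] in_sub_anc[OF xU], of m l] dep_anc[OF xU] by simp
        then show False using yl y(2) sub_trans by blast
      qed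
      then show ?thesis using y(1) by blast
    qed
    then obtain y where yX: "y \<in> X" and yl: "\<And>l. l < i \<Longrightarrow> y \<notin> sub ((par ^^ l) x)" by blast
    have yy2: "y \<in> sub y2" and dy: "dep v + 2 * r < dep y + \<alpha>" using yX unfolding X_def by auto
    have yU: "y \<in> U" using yy2 sub_subset by auto
    let ?P = "\<lambda>u m. (\<lambda>l. (par ^^ l) u) ` {..<m}"
    have card1: "\<alpha> \<le> card (sub y1)"
      using card_mono[OF finite_sub anc_subset_sub[OF y1(3), of \<alpha>]] card_anc[OF wU, of \<alpha>] dw y1(2) by simp
    have "?P x i \<inter> ?P y (dep y - dep v) = {}"
    proof (rule ccontr)
      assume "\<not> ?thesis"
      then obtain l k where lk: "l < i" "k < dep y - dep v" "(par ^^ l) x = (par ^^ k) y" by auto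
      then have "y \<in> sub ((par ^^ l) x)" using in_sub_anc[OF yU, of k] by simp
      then show False using yl lk(1) by blast
    qed
    then have "card (?P x i \<union> ?P y (dep y - dep v)) = i + (dep y - dep v)"
      using card_anc[OF xU, of i] card_anc[OF yU, of "dep y - dep v"] i\<beta> dx
      by (subst card_Un_disjoint) auto
    moreover have "?P x i \<union> ?P y (dep y - dep v) \<subseteq> sub y2"
      using anc_subset_sub[OF y2(3), of i] anc_subset_sub[OF yy2, of "dep y - dep v"] i\<beta> dx y2(2) by simp
    ultimately have "i + (dep y - dep v) \<le> card (sub y2)"
      using card_mono[OF finite_sub] by metis
    then have card12: "2 * r + 1 + i \<le> card (sub y1) + card (sub y2)" using card1 dy by linarith
    have cov12: "sub y2 \<subseteq> gball E c1 r \<union> gball E z i"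
    proof
      fix b assume b: "b \<in> sub y2"
      show "b \<in> gball E c1 r \<union> gball E z i"
      proof (cases "b \<in> X")
        case True then show ?thesis using Xz by auto
      next
        case False
        then have "dep b + \<alpha> \<le> dep v + 2 * r" using b unfolding X_def by auto
        then have "b \<in> gball E c1 r"
          using b sub2 c1v dc1 \<alpha>r by (intro sub_gball[of c1 v]) auto
        then show ?thesis by simp
      qed
    qed
    have "sub y1 \<union> sub y2 \<subseteq> gball E c1 r \<union> gball E z i" using cov1 cov12 by blast
    moreover have "v \<notin> sub y1 \<union> sub y2" using sub_dep y1(2) y2(2) by fastforce
    moreover have "\<rho> \<notin> sub y1 \<union> sub y2" using root_in_sub root12 by blast
    moreover have "insert v (sub y1) \<subseteq> gball E c1 r" "insert v (sub y2) \<subseteq> gball E c2 r"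
      using v1 v2 cov1 cov2 by simp_all
    moreover have "conn E (U - sub y1)" "conn E (U - sub y2)" "conn E (U - (sub y1 \<union> sub y2))"
      using conn_remove_sub[OF root12(1) root12(1)] conn_remove_sub[OF root12(2) root12(2)]
        conn_remove_sub[OF root12] by simp_all
    ultimately have ?P3
      using vU sub_subset[of y1] sub_subset[of y2] disj card12
      by - (rule exI[of _ v], rule exI[of _ c1], rule exI[of _ c2], rule exI[of _ z], rule exI[of _ i],
          rule exI[of _ "sub y1"], rule exI[of _ "sub y2"], intro conjI)
    then show ?thesis by blast
  qed
qed

end

lemma conn_rooted_tree:
  assumes "symp E" "finite U" "conn E U" "\<rho> \<in> U"
  obtains par dep where "rooted_tree E U \<rho> par dep"
proof -
  let ?R = "\<lambda>a b. E a b \<and> a \<in> U \<and> b \<in> U"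
  define dep where "dep u = (LEAST k. (?R ^^ k) \<rho> u)" for u
  have reach: "(?R ^^ dep u) \<rho> u" if u: "u \<in> U" for u
  proof -
    have "?R\<^sup>*\<^sup>* \<rho> u" using assms u unfolding conn_def by blast
    then obtain k where "(?R ^^ k) \<rho> u" by (auto dest: rtranclp_imp_relpowp)
    then show ?thesis unfolding dep_def by (rule LeastI)
  qed
  have least: "dep u \<le> k" if "(?R ^^ k) \<rho> u" for u k
    unfolding dep_def using that by (rule Least_le)
  have "\<exists>y\<in>U. E y u \<and> dep u = Suc (dep y)" if u: "u \<in> U" "u \<noteq> \<rho>" for u
  proof (cases "dep u")
    case 0
    then show ?thesis using reach[OF u(1)] u(2) by simp
  next
    case (Suc m)
    then obtain y where y: "(?R ^^ m) \<rho> y" "?R y u" using reach[OF u(1)] by auto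
    have "(?R ^^ Suc (dep y)) \<rho> u" using reach[of y] y(2) by auto
    then have "dep u \<le> Suc (dep y)" by (rule least)
    then show ?thesis using Suc y least[OF y(1)] by (intro bexI[of _ y]) auto
  qed
  then obtain f where f: "\<And>u. u \<in> U \<Longrightarrow> u \<noteq> \<rho> \<Longrightarrow> f u \<in> U \<and> E (f u) u \<and> dep u = Suc (dep (f u))"
    by metis
  have "dep \<rho> = 0" using least[of 0 \<rho>] by simp
  then have "rooted_tree E U \<rho> (f(\<rho> := \<rho>)) dep"
    using f assms by unfold_locales auto
  then show thesis by (rule that)
qed

subsection \<open>Covering connected sets by balls of prescribed radii\<close>

text \<open>
  Exempting \<open>\<rho>\<close> costs nothing: the first ball already reaches the vertex at which the remaining
  graph is then rooted. This gains the one vertex that the bound needs.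
\<close>

definition coverable :: "('a \<Rightarrow> 'a \<Rightarrow> bool) \<Rightarrow> nat set \<Rightarrow> nat \<Rightarrow> bool" where
  "coverable E A n \<longleftrightarrow> (\<forall>U \<rho>. finite U \<longrightarrow> conn E U \<longrightarrow> \<rho> \<in> U \<longrightarrow> card U \<le> Suc n \<longrightarrow>
     (\<exists>c. U - {\<rho>} \<subseteq> (\<Union>a\<in>A. gball E (c a) a)))"

definition reducible :: "('a \<Rightarrow> 'a \<Rightarrow> bool) \<Rightarrow> nat \<Rightarrow> nat set \<Rightarrow> nat \<Rightarrow> bool" where
  "reducible E r B n \<longleftrightarrow> (\<forall>i. 2 * r + 1 + i \<le> n \<longrightarrow>
     coverable E B (n - (r + 1 + i div 2)) \<or> (\<exists>a\<in>B. i \<le> a \<and> coverable E (B - {a}) (n - (2 * r + 1 + i))))"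

lemma coverable_mono: "coverable E A n \<Longrightarrow> m \<le> n \<Longrightarrow> coverable E A m"
  unfolding coverable_def by (meson Suc_le_mono order_trans)

lemma coverable_0: "coverable E A 0"
  unfolding coverable_def
proof (intro allI impI)
  fix U :: "'a set" and \<rho>
  assume "finite U" "\<rho> \<in> U" "card U \<le> Suc 0"
  then have "U - {\<rho>} = {}" using card_le_Suc0_iff_eq by blast
  then show "\<exists>c. U - {\<rho>} \<subseteq> (\<Union>a\<in>A. gball E (c a) a)" by auto
qed

lemma coverable_extend:
  assumes "coverable E B m" "finite U" "R \<subseteq> U" "conn E (U - R)" "\<rho> \<in> U - R" "card U \<le> Suc m + card R"
    and "R \<subseteq> gball E c r" "r \<notin> B"
  shows "\<exists>f. U - {\<rho>} \<subseteq> (\<Union>a\<in>insert r B. gball E (f a) a) \<and> f r = c"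
proof -
  have "card (U - R) \<le> Suc m" using assms(2,3,6) by (simp add: card_Diff_subset finite_subset)
  then obtain f where f: "U - R - {\<rho>} \<subseteq> (\<Union>a\<in>B. gball E (f a) a)"
    using assms(1,2,4,5) unfolding coverable_def by blast
  have "(\<Union>a\<in>B. gball E ((f(r := c)) a) a) = (\<Union>a\<in>B. gball E (f a) a)"
    using assms(8) by (intro SUP_cong) auto
  then have "U - {\<rho>} \<subseteq> (\<Union>a\<in>insert r B. gball E ((f(r := c)) a) a)"
    using f assms(7) by auto
  then show ?thesis by (intro exI[of _ "f(r := c)"]) simp
qed

lemma coverable_extend_pair:
  assumes "coverable E (B - {b}) m" "finite U" "R \<subseteq> U" "conn E (U - R)" "\<rho> \<in> U - R" "card U \<le> Suc m + card R"
    and "R \<subseteq> gball E c r \<union> gball E z b" "r \<notin> B" "b \<in> B"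
  shows "\<exists>f. U - {\<rho>} \<subseteq> (\<Union>a\<in>insert r B. gball E (f a) a) \<and> f r = c"
proof -
  have "card (U - R) \<le> Suc m" using assms(2,3,6) by (simp add: card_Diff_subset finite_subset)
  then obtain f where f: "U - R - {\<rho>} \<subseteq> (\<Union>a\<in>B - {b}. gball E (f a) a)"
    using assms(1,2,4,5) unfolding coverable_def by blast
  define g where "g = f(r := c, b := z)"
  have "r \<noteq> b" using assms(8,9) by auto
  then have R: "R \<subseteq> gball E (g r) r \<union> gball E (g b) b" using assms(7) unfolding g_def by simp
  have f': "U - R - {\<rho>} \<subseteq> (\<Union>a\<in>B - {b}. gball E (g a) a)"
  proof
    fix x assume "x \<in> U - R - {\<rho>}"
    then obtain a where "a \<in> B - {b}" "x \<in> gball E (f a) a" using f by blast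
    moreover have "a \<noteq> r" using \<open>a \<in> B - {b}\<close> assms(8) by auto
    ultimately show "x \<in> (\<Union>a\<in>B - {b}. gball E (g a) a)"
      unfolding g_def by (intro UN_I[of a]) auto
  qed
  have "U - {\<rho>} \<subseteq> (\<Union>a\<in>insert r B. gball E (g a) a)"
  proof
    fix x assume x: "x \<in> U - {\<rho>}"
    show "x \<in> (\<Union>a\<in>insert r B. gball E (g a) a)"
    proof (cases "x \<in> R")
      case True
      then have "x \<in> gball E (g r) r \<or> x \<in> gball E (g b) b" using R by blast
      then show ?thesis using assms(9) by (auto intro: UN_I[of r] UN_I[of b])
    next
      case False
      then obtain a where "a \<in> B - {b}" "x \<in> gball E (g a) a" using x f' by blast
      then show ?thesis by (intro UN_I[of a]) auto
    qed
  qed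
  moreover have "g r = c" unfolding g_def using \<open>r \<noteq> b\<close> by simp
  ultimately show ?thesis by blast
qed

lemma cover_cases:
  assumes "symp E" "r \<notin> B" "reducible E r B n"
    and "finite U" "conn E U" "\<rho> \<in> U" "card U \<le> Suc n"
  shows "(\<exists>c. U \<subseteq> gball E c r)
   \<or> (\<exists>c v R. v \<in> U \<and> v \<noteq> \<rho> \<and> v \<notin> R \<and> \<rho> \<notin> R \<and> R \<subseteq> U \<and> insert v R \<subseteq> gball E c r
        \<and> conn E (U - R) \<and> conn E (U - insert v R) \<and> 2 * r \<le> card R)
   \<or> (\<exists>v. \<forall>\<rho>'\<in>{\<rho>, v}. \<exists>f. U - {\<rho>'} \<subseteq> (\<Union>a\<in>insert r B. gball E (f a) a) \<and> v \<in> gball E (f r) r)"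
    (is "?P1 \<or> ?P2 \<or> ?P3")
proof -
  obtain par dep where "rooted_tree E U \<rho> par dep"
    by (rule conn_rooted_tree[OF assms(1,4,5,6)])
  then interpret rooted_tree E U \<rho> par dep .
  have P3I: ?P3 if v: "v \<in> U" and C: "C1 \<subseteq> U" "C2 \<subseteq> U" "C1 \<inter> C2 = {}"
    and vC: "v \<notin> C1 \<union> C2" and \<rho>C: "\<rho> \<notin> C1 \<union> C2"
    and c1: "insert v C1 \<subseteq> gball E c1 r" and c2: "insert v C2 \<subseteq> gball E c2 r"
    and c12: "C1 \<union> C2 \<subseteq> gball E c1 r \<union> gball E z i"
    and conn: "conn E (U - C1)" "conn E (U - C2)" "conn E (U - (C1 \<union> C2))"
    and card: "2 * r + 1 + i \<le> card C1 + card C2"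
    for v c1 c2 z i C1 C2
  proof -
    have fin: "finite C1" "finite C2" using C(1,2) assms(4) by (blast intro: finite_subset)+
    have card12: "card (C1 \<union> C2) = card C1 + card C2" using fin C(3) by (rule card_Un_disjoint)
    have "card (C1 \<union> C2) \<le> card (U - {\<rho>})" using assms(4) C \<rho>C by (intro card_mono) auto
    then have le: "2 * r + 1 + i \<le> n" using card card12 assms(4,6,7) by simp
    have single: ?P3 if "coverable E B (n - (r + 1 + i div 2))" "C \<subseteq> U" "v \<notin> C" "\<rho> \<notin> C"
      "insert v C \<subseteq> gball E c r" "conn E (U - C)" "r + 1 + i div 2 \<le> card C" for C c
    proof (intro exI[of _ v] ballI)
      fix \<rho>' assume "\<rho>' \<in> {\<rho>, v}"
      then have "\<rho>' \<in> U - C" using that(3,4) assms(6) v by auto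
      moreover have "card U \<le> Suc (n - (r + 1 + i div 2)) + card C" using that(7) le assms(7) by linarith
      moreover have "C \<subseteq> gball E c r" using that(5) by simp
      ultimately have "\<exists>f. U - {\<rho>'} \<subseteq> (\<Union>a\<in>insert r B. gball E (f a) a) \<and> f r = c"
        by (intro coverable_extend[OF that(1) assms(4) that(2) that(6)] assms(2))
      then show "\<exists>f. U - {\<rho>'} \<subseteq> (\<Union>a\<in>insert r B. gball E (f a) a) \<and> v \<in> gball E (f r) r"
        using that(5) by auto
    qed
    consider "coverable E B (n - (r + 1 + i div 2))"
      | a where "a \<in> B" "i \<le> a" "coverable E (B - {a}) (n - (2 * r + 1 + i))"
      using assms(3) le unfolding reducible_def by blast
    then show ?P3
    proof cases
      case 1
      show ?P3
      proof (cases "r + 1 + i div 2 \<le> card C1")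
        case True
        then show ?thesis using single[OF 1 C(1)] vC \<rho>C c1 conn by blast
      next
        case False
        then have "r + 1 + i div 2 \<le> card C2" using card by linarith
        then show ?thesis using single[OF 1 C(2)] vC \<rho>C c2 conn by blast
      qed
    next
      case 2
      show ?P3
      proof (intro exI[of _ v] ballI)
        fix \<rho>' assume "\<rho>' \<in> {\<rho>, v}"
        then have "\<rho>' \<in> U - (C1 \<union> C2)" using vC \<rho>C assms(6) v by auto
        moreover have "C1 \<union> C2 \<subseteq> gball E c1 r \<union> gball E z a"
          using c12 gball_mono[OF 2(2), of E z] by blast
        moreover have "card U \<le> Suc (n - (2 * r + 1 + i)) + card (C1 \<union> C2)"
          using card card12 le assms(7) by linarith
        moreover have "C1 \<union> C2 \<subseteq> U" using C by simp
        ultimately have "\<exists>f. U - {\<rho>'} \<subseteq> (\<Union>a\<in>insert r B. gball E (f a) a) \<and> f r = c1"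
          by (intro coverable_extend_pair[OF 2(3) assms(4) _ conn(3)] assms(2) 2(1))
        then show "\<exists>f. U - {\<rho>'} \<subseteq> (\<Union>a\<in>insert r B. gball E (f a) a) \<and> v \<in> gball E (f r) r"
          using c1 by auto
      qed
    qed
  qed
  show ?thesis using detach_branches[of r]
  proof (elim disjE)
    assume ?P1
    then show ?thesis by (rule disjI1)
  next
    assume ?P2
    then show ?thesis by (rule disjI1[THEN disjI2])
  qed (elim exE conjE, rule disjI2, rule disjI2, rule P3I)
qed

lemma coverable_step:
  assumes "symp E" "r \<notin> B" "reducible E r B n"
    and "2 * r + 1 \<le> n \<Longrightarrow> coverable E B (n - (2 * r + 1))"
  shows "coverable E (insert r B) n"
  unfolding coverable_def
proof (intro allI impI)
  fix U :: "'a set" and \<rho>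
  assume U: "finite U" "conn E U" "\<rho> \<in> U" "card U \<le> Suc n"
  let ?goal = "\<exists>c. U - {\<rho>} \<subseteq> (\<Union>a\<in>insert r B. gball E (c a) a)"
  have G1: ?goal if "U \<subseteq> gball E c r" for c
    using that by (intro exI[of _ "\<lambda>_. c"]) auto
  have G2: ?goal if "v \<in> U" "v \<noteq> \<rho>" "v \<notin> R" "\<rho> \<notin> R" "R \<subseteq> U" "insert v R \<subseteq> gball E c r"
    "conn E (U - insert v R)" "2 * r \<le> card R" for c v R
  proof -
    have "finite R" using that(5) U(1) by (rule finite_subset)
    then have card: "2 * r + 1 \<le> card (insert v R)" using that by simp
    have "card (insert v R) \<le> card (U - {\<rho>})" using that U by (intro card_mono) auto
    then have le: "2 * r + 1 \<le> n" using card U by simp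
    have "card U \<le> Suc (n - (2 * r + 1)) + card (insert v R)" using card le U(4) by linarith
    moreover have "\<rho> \<in> U - insert v R" "insert v R \<subseteq> U" using that U(3) by auto
    ultimately have "\<exists>f. U - {\<rho>} \<subseteq> (\<Union>a\<in>insert r B. gball E (f a) a) \<and> f r = c"
      using that(6) by (intro coverable_extend[OF assms(4)[OF le] U(1) _ that(7)] assms(2))
    then show ?thesis by blast
  qed
  show ?goal using cover_cases[OF assms(1-3) U]
  proof (elim disjE)
    assume "\<exists>v. \<forall>\<rho>'\<in>{\<rho>, v}. \<exists>f. U - {\<rho>'} \<subseteq> (\<Union>a\<in>insert r B. gball E (f a) a) \<and> v \<in> gball E (f r) r"
    then show ?goal by blast
  qed (elim exE conjE, rule G1 G2, assumption+)+
qed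

lemma cover_step:
  assumes "symp E" "r \<notin> B" "reducible E r B n" "coverable E B (n - 2 * r)"
    and U: "finite U" "conn E U" "U \<noteq> {}" "card U \<le> Suc n"
  shows "\<exists>c. U \<subseteq> (\<Union>a\<in>insert r B. gball E (c a) a)"
proof -
  obtain \<rho> where \<rho>: "\<rho> \<in> U" using U by auto
  let ?goal = "\<exists>c. U \<subseteq> (\<Union>a\<in>insert r B. gball E (c a) a)"
  have G1: ?goal if "U \<subseteq> gball E c r" for c
    using that by (intro exI[of _ "\<lambda>_. c"]) auto
  have G2: ?goal if h: "v \<in> U" "v \<noteq> \<rho>" "v \<notin> R" "R \<subseteq> U" "insert v R \<subseteq> gball E c r"
    "conn E (U - R)" "2 * r \<le> card R" "\<rho> \<notin> R" for c v R
  proof -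
    have "card R \<le> card (U - {v, \<rho>})" using h U by (intro card_mono) auto
    also have "\<dots> \<le> card (U - {\<rho>})" using U by (intro card_mono) auto
    finally have le: "2 * r \<le> n" using h(7) U \<rho> by simp
    have "card U \<le> Suc (n - 2 * r) + card R" using h(7) le U(4) by linarith
    moreover have "v \<in> U - R" "R \<subseteq> gball E c r" using h by auto
    ultimately obtain f where "U - {v} \<subseteq> (\<Union>a\<in>insert r B. gball E (f a) a)" "f r = c"
      using coverable_extend[OF assms(4) U(1) h(4,6) _ _ _ assms(2)] by blast
    then show ?thesis using h(5) by (intro exI[of _ f]) auto
  qed
  have G3: ?goal if "U - {v} \<subseteq> (\<Union>a\<in>insert r B. gball E (f a) a)" "v \<in> gball E (f r) r" for f v
    using that by (intro exI[of _ f]) auto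
  show ?goal using cover_cases[OF assms(1-3) U(1,2) \<rho> U(4)]
  proof (elim disjE)
    assume "\<exists>v. \<forall>\<rho>'\<in>{\<rho>, v}. \<exists>f. U - {\<rho>'} \<subseteq> (\<Union>a\<in>insert r B. gball E (f a) a) \<and> v \<in> gball E (f r) r"
    then obtain v where "\<forall>\<rho>'\<in>{\<rho>, v}. \<exists>f. U - {\<rho>'} \<subseteq> (\<Union>a\<in>insert r B. gball E (f a) a) \<and> v \<in> gball E (f r) r" ..
    then have "\<exists>f. U - {v} \<subseteq> (\<Union>a\<in>insert r B. gball E (f a) a) \<and> v \<in> gball E (f r) r" by simp
    then show ?goal using G3 by blast
  qed (elim exE conjE, rule G1 G2, assumption+)+
qed

subsection \<open>The number of vertices covered by greedy pairing\<close>

text \<open>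
  Spent small radii are like parked cars: a request \<open>i\<close> takes the least free place \<open>a \<ge> i\<close>, so it
  is at least the start of the block of taken places containing \<open>a\<close>. This makes \<open>budget\<close>, four times
  the number of vertices that the radii \<open>A \<subseteq> {..<R}\<close> still cover, exactly balanced in a pairing step.
\<close>

definition block_start :: "nat set \<Rightarrow> nat \<Rightarrow> nat" where
  "block_start A d = (LEAST b. {b..d} \<inter> A = {})"

lemma block_start_le: "{b..d} \<inter> A = {} \<Longrightarrow> block_start A d \<le> b"
  unfolding block_start_def by (rule Least_le)

lemma block_start_disjoint: "{block_start A d..d} \<inter> A = {}"
  unfolding block_start_def by (rule LeastI[of _ "Suc d"]) simp

lemma block_start_mono: "A \<subseteq> B \<Longrightarrow> block_start A d \<le> block_start B d"
  using block_start_disjoint[of B d] by (intro block_start_le) blast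

lemma card_le_block_start:
  assumes "A \<subseteq> {..<d}" shows "card A \<le> block_start A d"
proof -
  have "A \<subseteq> {..<block_start A d}"
    using assms block_start_disjoint[of A d] by (force simp: not_less)
  then show ?thesis using card_mono[of "{..<block_start A d}" A] by simp
qed

definition budget :: "nat set \<Rightarrow> nat \<Rightarrow> int" where
  "budget A R = int (card A) * (4 * int R - int (card A)) - 4 * (\<Sum>d\<in>{..<R} - A. int (block_start A d))"

lemma budget_single:
  assumes "B \<subseteq> {..<r}"
  shows "budget (insert r B) (Suc r) \<le> budget B r + 4 * int r + 3 + 2 * int (card B)"
proof -
  have "finite B" "r \<notin> B" using assms finite_subset by auto
  have "(\<Sum>d\<in>{..<r} - B. int (block_start B d)) \<le> (\<Sum>d\<in>{..<r} - B. int (block_start (insert r B) d))"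
    by (intro sum_mono) (simp add: block_start_mono subset_insertI)
  moreover have "{..<Suc r} - insert r B = {..<r} - B" by auto
  ultimately show ?thesis
    using \<open>finite B\<close> \<open>r \<notin> B\<close> unfolding budget_def by (simp add: algebra_simps)
qed

lemma budget_pair:
  assumes "B \<subseteq> {..<r}" "a \<in> B" "i \<le> a" "\<And>b. b \<in> B \<Longrightarrow> i \<le> b \<Longrightarrow> a \<le> b"
  shows "budget (insert r B) (Suc r) \<le> budget (B - {a}) r + 4 * int (2 * r + 1 + i)"
proof -
  have fin: "finite B" "r \<notin> B" using assms finite_subset by auto
  have "{..<r} - (B - {a}) = insert a ({..<r} - B)" using assms by auto
  then have "(\<Sum>d\<in>{..<r} - (B - {a}). int (block_start (B - {a}) d))
      = int (block_start (B - {a}) a) + (\<Sum>d\<in>{..<r} - B. int (block_start (B - {a}) d))"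
    using assms(2) by simp
  also have "(\<Sum>d\<in>{..<r} - B. int (block_start (B - {a}) d))
      \<le> (\<Sum>d\<in>{..<r} - B. int (block_start (insert r B) d))"
    by (intro sum_mono) (auto intro: block_start_mono)
  also have "block_start (B - {a}) a \<le> i"
    using assms(4) by (intro block_start_le) fastforce
  finally have sum: "(\<Sum>d\<in>{..<r} - (B - {a}). int (block_start (B - {a}) d))
      \<le> int i + (\<Sum>d\<in>{..<r} - B. int (block_start (insert r B) d))" by simp
  have "card B = Suc (card (B - {a}))" using fin assms(2) by (metis card_Suc_Diff1)
  then have card: "int (card (insert r B)) = int (card (B - {a})) + 2" using fin by simp
  have "{..<Suc r} - insert r B = {..<r} - B" by auto
  then show ?thesis
    using sum unfolding budget_def card by (simp add: algebra_simps)
qed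

lemma budget_skip:
  assumes "A \<subseteq> {..<r}" shows "budget A (Suc r) \<le> budget A r"
proof -
  have "{..<Suc r} - A = insert r ({..<r} - A)" using assms by auto
  then show ?thesis
    using card_le_block_start[OF assms] mult_left_mono[of "int (card A)" "int (block_start A r)" 4]
    unfolding budget_def by (simp add: algebra_simps)
qed

lemma budget_mod: "4 dvd budget A R + int (card A)^2"
proof -
  have "budget A R + int (card A)^2
      = 4 * (int (card A) * int R - (\<Sum>d\<in>{..<R} - A. int (block_start A d)))"
    unfolding budget_def by (simp add: power2_eq_square algebra_simps)
  then show ?thesis by simp
qed

lemma reducible_budget:
  assumes IH: "\<And>A m. A \<subseteq> {..<r} \<Longrightarrow> 4 * int m \<le> budget A r + 3 \<Longrightarrow> coverable E A m"
    and B: "B \<subseteq> {..<r}" and n: "4 * int n \<le> budget (insert r B) (Suc r) + 3"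
  shows "reducible E r B n"
  unfolding reducible_def
proof (intro allI impI)
  fix i assume i: "2 * r + 1 + i \<le> n"
  show "coverable E B (n - (r + 1 + i div 2)) \<or> (\<exists>a\<in>B. i \<le> a \<and> coverable E (B - {a}) (n - (2 * r + 1 + i)))"
  proof (cases "\<exists>a\<in>B. i \<le> a")
    case True
    define a where "a = (LEAST a. a \<in> B \<and> i \<le> a)"
    have a: "a \<in> B" "i \<le> a" using True LeastI_ex[of "\<lambda>a. a \<in> B \<and> i \<le> a"] unfolding a_def by auto
    have "a \<le> b" if "b \<in> B" "i \<le> b" for b unfolding a_def using that by (intro Least_le) auto
    from budget_pair[OF B a this]
    have "4 * int (n - (2 * r + 1 + i)) \<le> budget (B - {a}) r + 3" using n i by simp
    then have "coverable E (B - {a}) (n - (2 * r + 1 + i))" using B by (intro IH) auto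
    then show ?thesis using a by blast
  next
    case False
    then have Bi: "B \<subseteq> {..<i}" by (auto simp: not_le)
    then have m: "card B \<le> i" using card_mono[of "{..<i}" B] by simp
    have "4 * int (n - (r + 1 + i div 2)) \<le> budget B r + 3 + (2 * int (card B) - 1 - 4 * int (i div 2))"
      using n i budget_single[OF B] by (simp add: of_nat_diff)
    moreover have "4 * int (n - (r + 1 + i div 2)) \<le> budget B r + 3"
    proof (cases "even i \<or> card B < i")
      case True
      then have "2 * card B \<le> 4 * (i div 2) + 1" using m by (auto elim!: evenE oddE)
      then show ?thesis using calculation by linarith
    next
      case False
      then have odd: "odd (card B)" "card B = i" using m by auto
      then obtain q where q: "card B = 2 * q + 1" by (auto elim: oddE)
      have "4 * int (n - (r + 1 + i div 2)) \<le> budget B r + 4"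
        using calculation odd q by simp
      moreover obtain t where "budget B r + int (card B)^2 = 4 * t" using budget_mod[of B r] by (auto elim: dvdE)
      then have "budget B r + 1 = 4 * (t - int q^2 - int q)"
        using q by (simp add: power2_eq_square algebra_simps)
      moreover have "4 * x \<le> b + 3" if "4 * x \<le> b + 4" "b + 1 = 4 * y" for x y b :: int
        using that by presburger
      ultimately show ?thesis by blast
    qed
    ultimately have "coverable E B (n - (r + 1 + i div 2))" using B by (intro IH) auto
    then show ?thesis by blast
  qed
qed

lemma coverable_budget:
  assumes "symp E"
  shows "A \<subseteq> {..<R} \<Longrightarrow> 4 * int n \<le> budget A R + 3 \<Longrightarrow> coverable E A n"
proof (induction R arbitrary: A n)
  case 0
  then have "n = 0" unfolding budget_def by auto
  then show ?case by (simp add: coverable_0)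
next
  case (Suc r)
  show ?case
  proof (cases "r \<in> A")
    case False
    then have "A \<subseteq> {..<r}" using Suc.prems(1) by (auto simp: less_Suc_eq)
    then show ?thesis using Suc budget_skip[of A r] by (intro Suc.IH) auto
  next
    case True
    define B where "B = A - {r}"
    have A: "A = insert r B" and B: "B \<subseteq> {..<r}" "r \<notin> B"
      using True Suc.prems(1) unfolding B_def by (auto simp: less_Suc_eq)
    have "card B \<le> r" using card_mono[of "{..<r}" B] B by simp
    then have "coverable E B (n - (2 * r + 1))" if "2 * r + 1 \<le> n"
      using that Suc.prems(2) budget_single[OF B(1)] unfolding A
      by (intro Suc.IH[OF B(1)]) (simp add: of_nat_diff)
    moreover have "reducible E r B n"
      using Suc.IH B(1) Suc.prems(2) unfolding A by (rule reducible_budget)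
    ultimately show ?thesis unfolding A using assms B(2) by (intro coverable_step) auto
  qed
qed

lemma budget_lessThan: "budget {..<k} k = 3 * int k ^ 2"
  unfolding budget_def by (simp add: power2_eq_square)

subsection \<open>Six rounds\<close>

text \<open>For six rounds the greedy bound is 28 vertices, one less than required.\<close>

lemma coverable_large: "symp E \<Longrightarrow> n \<le> 2 * r \<Longrightarrow> coverable E {r} n"
  using coverable_step[of E r "{}" n] unfolding reducible_def by simp

lemma reducibleI:
  assumes "\<And>i. i < j \<Longrightarrow> \<exists>a\<in>B. i \<le> a \<and> coverable E (B - {a}) (n - (2 * r + 1 + i))"
    and "coverable E B m" "n \<le> m + r + 1 + j div 2"
  shows "reducible E r B n"
  unfolding reducible_def
proof (intro allI impI)
  fix i
  show "coverable E B (n - (r + 1 + i div 2)) \<or> (\<exists>a\<in>B. i \<le> a \<and> coverable E (B - {a}) (n - (2 * r + 1 + i)))"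
  proof (cases "i < j")
    case False
    then have "j div 2 \<le> i div 2" by (intro div_le_mono) simp
    then have "coverable E B (n - (r + 1 + i div 2))" using assms(3) by (intro coverable_mono[OF assms(2)]) simp
    then show ?thesis ..
  qed (use assms(1) in blast)
qed

lemma coverable_insert:
  assumes "symp E" "r \<notin> B" "coverable E B m"
  shows "coverable E (insert r B) (m + r + 1)"
proof (rule coverable_step[OF assms(1,2)])
  show "reducible E r B (m + r + 1)" using assms(3) by (intro reducibleI[of 0]) auto
  show "coverable E B (m + r + 1 - (2 * r + 1))" by (rule coverable_mono[OF assms(3)]) simp
qed

lemma coverable_insert2:
  assumes "symp E" "r \<notin> B" "coverable E B m" "0 < r"
    and "a \<in> B" "coverable E (B - {a}) (m + 1 - r)" "b \<in> B" "1 \<le> b" "coverable E (B - {b}) (m - r)"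
  shows "coverable E (insert r B) (m + r + 2)"
proof (rule coverable_step[OF assms(1,2)])
  have "\<exists>a\<in>B. i \<le> a \<and> coverable E (B - {a}) (m + r + 2 - (2 * r + 1 + i))" if "i < 2" for i
  proof (cases "i = 0")
    case True
    then show ?thesis using assms(5,6) by (intro bexI[of _ a]) auto
  next
    case False
    then have "i = 1" using that by simp
    then show ?thesis using assms(7-9) by (intro bexI[of _ b]) auto
  qed
  then show "reducible E r B (m + r + 2)" using assms(3) by (intro reducibleI[of 2]) auto
  show "coverable E B (m + r + 2 - (2 * r + 1))" using assms(4) by (intro coverable_mono[OF assms(3)]) simp
qed

lemma coverable_six:
  assumes "symp E"
  shows "reducible E 5 {..<5} 28" "coverable E {..<5} 18"
proof -
  note ins = coverable_insert[OF assms] and ins2 = coverable_insert2[OF assms]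
  have w4: "coverable E {4} 8" using assms by (rule coverable_large) simp
  have w14: "coverable E {1, 4} 10" using ins[OF _ w4, of 1] by simp
  have w04: "coverable E {0, 4} 9" using ins[OF _ w4, of 0] by simp
  have w014: "coverable E {0, 1, 4} 11" using ins[OF _ w14, of 0] by simp
  have w124: "coverable E {1, 2, 4} 13"
    using ins2[of 2 "{1, 4}" 9 1 1] coverable_mono[OF w14, of 9] coverable_mono[OF w4, of 7] w4
    by (simp add: insert_commute)
  have w024: "coverable E {0, 2, 4} 12"
    using ins[OF _ w04, of 2] by (simp add: insert_commute)
  have w0124: "coverable E {0, 1, 2, 4} 15"
    using ins2[of 2 "{0, 1, 4}" 11 0 1] w014 w14 w04 by (simp add: insert_commute insert_Diff_if)
  have w01234: "coverable E {0, 1, 2, 3, 4} 20"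
    using ins2[of 3 "{0, 1, 2, 4}" 15 0 1] w0124 w124 w024 by (simp add: insert_commute insert_Diff_if)
  have w1234: "coverable E {1, 2, 3, 4} 17" using ins[OF _ w124, of 3] by (simp add: insert_commute)
  have w0234: "coverable E {0, 2, 3, 4} 16" using ins[OF _ w024, of 3] by (simp add: insert_commute)
  have w0134: "coverable E {0, 1, 3, 4} 15" using ins[OF _ w014, of 3] by (simp add: insert_commute)
  have five: "{..<5} = {0, 1, 2, 3, 4 :: nat}" by auto
  show "coverable E {..<5} 18" unfolding five using w01234 by (rule coverable_mono) simp
  show "reducible E 5 {..<5} 28" unfolding five
  proof (rule reducibleI[of 4])
    fix i :: nat assume "i < 4"
    then consider "i = 0" | "i = 1" | "i = 2" | "i = 3" by linarith
    then show "\<exists>a\<in>{0, 1, 2, 3, 4}. i \<le> a \<and> coverable E ({0, 1, 2, 3, 4} - {a}) (28 - (2 * 5 + 1 + i))"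
      using w1234 w0234 w0134 coverable_mono[OF w0124, of 14]
      by cases (rule bexI[of _ i]; simp add: insert_Diff_if)+
  qed (use w01234 in auto)
qed

lemma reducible_mono: "reducible E r B n \<Longrightarrow> m \<le> n \<Longrightarrow> reducible E r B m"
  unfolding reducible_def by (meson diff_le_mono order_trans coverable_mono)

lemma cover_bound:
  assumes "symp E" "finite U" "conn E U" "U \<noteq> {}" "2 \<le> k" "3 * card U + 3 \<le> 2 * k^2 + 3 * k"
  shows "\<exists>c. U \<subseteq> (\<Union>a<k. gball E (c a) a)"
proof -
  define r where "r = k - 1"
  have k: "k = Suc r" "{..<k} = insert r {..<r}" using assms(5) unfolding r_def by auto
  define n where "n = card U - 1"
  have "0 < card U" using assms(2,4) by (simp add: card_gt_0_iff)
  then have U: "card U = Suc n" unfolding n_def by simp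
  have "reducible E r {..<r} n \<and> coverable E {..<r} (n - 2 * r)"
  proof (cases "k = 6")
    case True
    then have r: "r = 5" and "n \<le> 28" using assms(6) U unfolding r_def by (auto simp: power2_eq_square)
    show ?thesis unfolding r
      using reducible_mono[OF coverable_six(1)[OF assms(1)] \<open>n \<le> 28\<close>]
        coverable_mono[OF coverable_six(2)[OF assms(1)], of "n - 2 * 5"] \<open>n \<le> 28\<close> by simp
  next
    case False
    have n: "4 * n \<le> 3 * k^2 + 3"
    proof (cases "k = 5 \<or> k = 7")
      case True
      then show ?thesis using assms(6) U by (auto simp: power2_eq_square)
    next
      case False
      then have "\<bar>2\<bar> \<le> \<bar>int k - 6\<bar>" using \<open>k \<noteq> 6\<close> by linarith
      then have "2^2 \<le> (int k - 6)^2" by (simp only: abs_le_square_iff)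
      moreover have "3 * (int n + 1) + 3 \<le> 2 * int k^2 + 3 * int k"
        using assms(6) unfolding U by (simp flip: of_nat_le_iff[where 'a = int])
      ultimately have "4 * int n \<le> 3 * int k^2 + 3" by (simp add: power2_eq_square algebra_simps)
      then show ?thesis by (simp flip: of_nat_le_iff[where 'a = int])
    qed
    then have "4 * int n \<le> budget (insert r {..<r}) (Suc r) + 3"
      unfolding k(2)[symmetric] k(1)[symmetric] budget_lessThan by (simp flip: of_nat_le_iff[where 'a = int])
    then have "reducible E r {..<r} n" using coverable_budget[OF assms(1)] by (intro reducible_budget) auto
    moreover have "coverable E {..<r} (n - 2 * r)"
    proof (cases "2 * r \<le> n")
      case True
      have "4 * int n \<le> 3 * (int r + 1)^2 + 3"
        using n unfolding k(1) by (simp flip: of_nat_le_iff[where 'a = int] add: add.commute)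
      then have "4 * int (n - 2 * r) \<le> 3 * int r^2 + 3 + (3 - 2 * int r)"
        using True by (simp add: of_nat_diff power2_eq_square algebra_simps)
      moreover have "1 \<le> r" using assms(5) unfolding r_def by simp
      moreover have "4 * int (n - 2 * r) \<le> budget {..<r} r + 3"
      proof (cases "r = 1")
        case True
        then have "4 * int (n - 2 * r) \<le> 7" using calculation by simp
        then have "4 * int (n - 2 * r) \<le> 6" by presburger
        then show ?thesis unfolding budget_lessThan using True by simp
      next
        case False
        then show ?thesis unfolding budget_lessThan using calculation by linarith
      qed
      ultimately show ?thesis by (intro coverable_budget[OF assms(1)]) auto
    qed (simp add: coverable_0)
    ultimately show ?thesis ..
  qed
  then show ?thesis
    using cover_step[OF assms(1) _ _ _ assms(2,3,4), of r "{..<r}" n] U k(2) by auto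
qed

subsection \<open>From coverings to burning sequences\<close>

lemma covering_imp_burning:
  assumes G: "simple_graph V E" and cov: "V \<subseteq> (\<Union>a<k. gball E (c a) a)"
  shows "burning_number V E \<le> k"
proof -
  have EV: "u \<in> V" "v \<in> V" if "E u v" for u v using G that unfolding simple_graph_def by auto
  define ok where "ok xs \<longleftrightarrow> (\<forall>i<length xs. xs ! i \<in> V - burned V E (take i xs))" for xs
  have "\<exists>xs. ok xs \<and> burned V E xs \<subseteq> V \<and> (burned V E xs = V \<and> length xs \<le> j \<or>
      length xs = j \<and> (\<forall>l<j. V \<inter> gball E (c (k - 1 - l)) (j - 1 - l) \<subseteq> burned V E xs))" for j
  proof (induction j)
    case 0
    show ?case by (intro exI[of _ "[]"]) (auto simp: ok_def burned_def)
  next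
    case (Suc j)
    then obtain xs where xs: "ok xs" "burned V E xs \<subseteq> V" "burned V E xs = V \<and> length xs \<le> j \<or>
      length xs = j \<and> (\<forall>l<j. V \<inter> gball E (c (k - 1 - l)) (j - 1 - l) \<subseteq> burned V E xs)" by blast
    show ?case
    proof (cases "burned V E xs = V \<and> length xs \<le> j")
      case True
      then show ?thesis using xs by (intro exI[of _ xs]) auto
    next
      case False
      then have len: "length xs = j"
        and inv: "\<And>l. l < j \<Longrightarrow> V \<inter> gball E (c (k - 1 - l)) (j - 1 - l) \<subseteq> burned V E xs"
        and "burned V E xs \<noteq> V" using xs(3) by auto
      then obtain y where y: "y \<in> V - burned V E xs" using xs(2) by blast
      define t where "t = c (k - 1 - j)"
      define x where "x = (if t \<in> V - burned V E xs then t else y)"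
      have x: "x \<in> V - burned V E xs" unfolding x_def using y by simp
      have step: "burned V E (xs @ [x]) = burned V E xs \<union> {v \<in> V. \<exists>u\<in>burned V E xs. E u v} \<union> {x}"
        by (simp add: burned_def burn_step_def)
      have "ok (xs @ [x])"
        using xs(1) x unfolding ok_def by (auto simp: nth_append less_Suc_eq)
      moreover have "burned V E (xs @ [x]) \<subseteq> V" using step xs(2) x by auto
      moreover have "V \<inter> gball E (c (k - 1 - l)) (Suc j - 1 - l) \<subseteq> burned V E (xs @ [x])" if l: "l < Suc j" for l
      proof
        fix v assume v: "v \<in> V \<inter> gball E (c (k - 1 - l)) (Suc j - 1 - l)"
        then obtain q where q: "q \<le> j - l" "(E ^^ q) (c (k - 1 - l)) v" unfolding gball_def by auto
        show "v \<in> burned V E (xs @ [x])"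
        proof (cases "l = j")
          case True
          then have "v = t" using q unfolding t_def by auto
          then show ?thesis using v step unfolding x_def by auto
        next
          case False
          then have lj: "l < j" using l by simp
          show ?thesis
          proof (cases q)
            case 0
            then have "v = c (k - 1 - l)" using q(2) by simp
            then have "v \<in> burned V E xs" using inv[OF lj] v by auto
            then show ?thesis using step by simp
          next
            case (Suc p)
            then obtain u where u: "(E ^^ p) (c (k - 1 - l)) u" "E u v" using q(2) by auto
            have "p \<le> j - 1 - l" using q(1) Suc by simp
            then have "u \<in> burned V E xs" using inv[OF lj] u EV unfolding gball_def by blast
            then show ?thesis using step u(2) v by auto
          qed
        qed
      qed
      ultimately show ?thesis using len by (intro exI[of _ "xs @ [x]"]) auto
    qed
  qed
  from this[of k] obtain xs where xs: "ok xs" "burned V E xs \<subseteq> V" "burned V E xs = V \<and> length xs \<le> k \<or>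
      length xs = k \<and> (\<forall>l<k. V \<inter> gball E (c (k - 1 - l)) (k - 1 - l) \<subseteq> burned V E xs)" by blast
  have "burned V E xs = V \<and> length xs \<le> k"
  proof (rule ccontr)
    assume "\<not> ?thesis"
    then have inv: "\<And>l. l < k \<Longrightarrow> V \<inter> gball E (c (k - 1 - l)) (k - 1 - l) \<subseteq> burned V E xs"
      and len: "length xs = k" and ne: "burned V E xs \<noteq> V" using xs(3) by auto
    have "V \<subseteq> burned V E xs"
    proof
      fix v assume v: "v \<in> V"
      then obtain a where a: "a < k" "v \<in> gball E (c a) a" using cov by auto
      then show "v \<in> burned V E xs" using inv[of "k - 1 - a"] v by auto
    qed
    then show False using ne xs(2) by blast
  qed
  then have "burns V E xs" "length xs \<le> k" using xs(1) unfolding burns_def ok_def by auto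
  then have "burning_number V E \<le> length xs" unfolding burning_number_def by (intro Least_le) auto
  then show ?thesis using \<open>length xs \<le> k\<close> by simp
qed

theorem theorem1:
  fixes V :: "'a set" and E :: "'a \<Rightarrow> 'a \<Rightarrow> bool" and n :: nat
  assumes "simple_graph V E" and "connected_graph V E" and "card V = n"
  shows "int (burning_number V E) \<le> \<lceil>(-3 + sqrt (24 * real n + 33)) / 4\<rceil>"
proof -
  define x where "x = (-3 + sqrt (24 * real n + 33)) / 4"
  define k where "k = nat \<lceil>x\<rceil>"
  have fin: "finite V" "V \<noteq> {}" using assms unfolding simple_graph_def connected_graph_def by auto
  then have "1 \<le> n" unfolding assms(3)[symmetric] by (simp add: Suc_le_eq card_gt_0_iff)
  then have "7 < sqrt (24 * real n + 33)" by (intro real_less_rsqrt) (simp add: power2_eq_square)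
  then have "1 < x" unfolding x_def by simp
  then have ceil: "int k = \<lceil>x\<rceil>" and "2 \<le> k" unfolding k_def by linarith+
  have "x \<le> real k" using ceil by (metis le_of_int_ceiling of_int_of_nat_eq)
  then have "sqrt (24 * real n + 33) \<le> 4 * real k + 3" unfolding x_def by simp
  then have "24 * real n + 33 \<le> (4 * real k + 3)\<^sup>2" by (rule sqrt_le_D)
  then have "real (3 * n + 3) \<le> real (2 * k^2 + 3 * k)" by (simp add: power2_eq_square algebra_simps)
  then have bound: "3 * card V + 3 \<le> 2 * k^2 + 3 * k" using assms(3) by (simp only: of_nat_le_iff)
  have "symp E" using assms(1) unfolding simple_graph_def symp_def by blast
  moreover have "conn E V"
  proof -
    have "(\<lambda>a b. E a b \<and> a \<in> V \<and> b \<in> V) = E" using assms(1) unfolding simple_graph_def by blast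
    then show ?thesis using assms(2) unfolding conn_def connected_graph_def by simp
  qed
  ultimately obtain c where "V \<subseteq> (\<Union>a<k. gball E (c a) a)"
    using cover_bound[OF _ fin(1) _ fin(2) \<open>2 \<le> k\<close> bound] by blast
  then have "burning_number V E \<le> k" by (rule covering_imp_burning[OF assms(1)])
  then show ?thesis using ceil unfolding x_def by simp
qed

end
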